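(* Let $K$ be a non-empty compact subset of $\mathbb{R}^d$. (i) Suppose there exists an increasing family $(E_\alpha)_{0<\alpha<\dim_{\mathcal P}(K)}$ of compact subsets of $K$ such that, for every $\alpha\in(0,\dim_{\mathcal P}(K))$, $\dim_{\mathcal P}(E_\alpha)=\alpha$ and $\mathcal{P}^\alpha(E_\alpha)>0$. Then there exists $\mu\in\mathcal{P}(K)$ such that, for every $\alpha\in(0,\dim_{\mathcal P}(K))$, $\dim_{\mathcal P}\big(E^+(\mu;\alpha)\big)=\alpha$. (ii) Suppose moreover that there exists an increasing family $(E_\alpha)_{0<\alpha<\dim_{\mathcal P}(K)}$ of compact subsets of $K$ such that, for every $\alpha\in(0,\dim_{\mathcal P}(K))$, $\dim_{\mathcal P}(E_\alpha)=\alpha$ and $\mathcal{H}^\alpha(E_\alpha)>0$. Then there exists $\mu\in\mathcal{P}(K)$ such that, for every $\alpha\in(0,\dim_{\mathcal P}(K))$, $\dim_{\mathcal H}\big(E(\mu;\alpha)\big)=\dim_{\mathcal P}\big(E(\mu;\alpha)\big)=\alpha$.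
   Context: $\mathcal{P}(K)$ is the set of Borel probability measures on $K$. $\mathcal{H}^\alpha$ and $\mathcal{P}^\alpha$ denote the $\alpha$-dimensional Hausdorff and packing measures, and $\dim_{\mathcal H}$, $\dim_{\mathcal P}$ the Hausdorff and packing dimensions. "Increasing family" means $E_\alpha\subset E_\beta$ whenever $\alpha\leq\beta$. For $\mu\in\mathcal{P}(K)$ and $x\in K$, the lower and upper local dimensions are $\underline{\dim}_{\rm loc}(\mu;x)=\liminf_{r\to 0}\frac{\log\mu(B(x,r))}{\log r}$ and $\overline{\dim}_{\rm loc}(\mu;x)=\limsup_{r\to 0}\frac{\log\mu(B(x,r))}{\log r}$ (with $\log 0=-\infty$, so both are $+\infty$ off the support of $\mu$); when they coincide the common value is $\dim_{\rm loc}(\mu;x)$. Set $E^+(\mu;\alpha)=\{x\in K:\ \overline{\dim}_{\rm loc}(\mu;x)=\alpha\}$ and $E(\mu;\alpha)=\{x\in K:\ \underline{\dim}_{\rm loc}(\mu;x)=\overline{\dim}_{\rm loc}(\mu;x)=\alpha\}$. *)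

theory Defs
  imports "HOL-Probability.Probability"
begin

text \<open>Hausdorff measures and dimension.\<close>

(* The convention diam(U)^0 = 1 for non-empty U is spelled out, since 0 powr 0 = 0.
   With it, the 0-dimensional Hausdorff measure is the counting measure. *)
definition diam_pow :: "real \<Rightarrow> 'a::metric_space set \<Rightarrow> ennreal" where
  "diam_pow s U =
     (if U = {} then 0 else if s = 0 then 1 else ennreal (diameter U powr s))"

(* Boundedness is explicit because diameter is a real number and says nothing about
   unbounded sets. Finite covers are included, as members of a cover may be empty. *)
definition hausdorff_premeasure :: "real \<Rightarrow> real \<Rightarrow> 'a::metric_space set \<Rightarrow> ennreal" where
  "hausdorff_premeasure s \<delta> A =
     (INF U \<in> {U :: nat \<Rightarrow> 'a set.
                 A \<subseteq> (\<Union>i. U i) \<and> (\<forall>i. bounded (U i) \<and> diameter (U i) \<le> \<delta>)}.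
        \<Sum>i. diam_pow s (U i))"

definition hausdorff_measure :: "real \<Rightarrow> 'a::metric_space set \<Rightarrow> ennreal" where
  "hausdorff_measure s A = (SUP \<delta> \<in> {0<..}. hausdorff_premeasure s \<delta> A)"

definition hausdorff_dim :: "'a::metric_space set \<Rightarrow> ereal" where
  "hausdorff_dim A = (INF s \<in> {s :: real. 0 \<le> s \<and> hausdorff_measure s A = 0}. ereal s)"

text \<open>Packing measures and dimension.\<close>

(* A packing is given by its set of pairs (centre, radius): countably many pairwise
   disjoint closed balls with centres in A and radii in (0, \<delta>]. *)
definition packings :: "real \<Rightarrow> 'a::metric_space set \<Rightarrow> ('a \<times> real) set set" where
  "packings \<delta> A =
     {F. countable F \<and> F \<subseteq> A \<times> {0<..\<delta>} \<and> disjoint_family_on (\<lambda>(x, r). cball x r) F}"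

definition packing_premeasure_at :: "real \<Rightarrow> real \<Rightarrow> 'a::metric_space set \<Rightarrow> ennreal" where
  "packing_premeasure_at s \<delta> A =
     (SUP F \<in> packings \<delta> A. \<Sum>\<^sub>\<infinity>(x, r)\<in>F. ennreal ((2 * r) powr s))"

definition packing_premeasure :: "real \<Rightarrow> 'a::metric_space set \<Rightarrow> ennreal" where
  "packing_premeasure s A = (INF \<delta> \<in> {0<..}. packing_premeasure_at s \<delta> A)"

(* The premeasure is only finitely subadditive, hence the additional countable cover. *)
definition packing_measure :: "real \<Rightarrow> 'a::metric_space set \<Rightarrow> ennreal" where
  "packing_measure s A =
     (INF U \<in> {U :: nat \<Rightarrow> 'a set. A \<subseteq> (\<Union>i. U i)}. \<Sum>i. packing_premeasure s (U i))"

definition packing_dim :: "'a::metric_space set \<Rightarrow> ereal" where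
  "packing_dim A = (INF s \<in> {s :: real. 0 \<le> s \<and> packing_measure s A = 0}. ereal s)"

text \<open>Probability measures on a set, and their local dimensions.\<close>

definition borel_prob_measures :: "'a::topological_space set \<Rightarrow> 'a measure set" where
  "borel_prob_measures K = {M. sets M = sets (restrict_space borel K) \<and> prob_space M}"

(* The logarithm on [0, \<infinity>), with log 0 = -\<infinity>. *)
definition ext_ln :: "real \<Rightarrow> ereal" where
  "ext_ln t = (if t = 0 then - \<infinity> else ereal (ln t))"

(* log M(B(x,r)) / log r. The ball is intersected with space M because a measure on K
   lives on the type of the ambient space, and cball is the ball of that space. *)
definition local_dim_ratio :: "'a::metric_space measure \<Rightarrow> 'a \<Rightarrow> real \<Rightarrow> ereal" where
  "local_dim_ratio M x r = ext_ln (measure M (cball x r \<inter> space M)) / ereal (ln r)"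

definition lower_local_dim :: "'a::metric_space measure \<Rightarrow> 'a \<Rightarrow> ereal" where
  "lower_local_dim M x = Liminf (at_right 0) (local_dim_ratio M x)"

definition upper_local_dim :: "'a::metric_space measure \<Rightarrow> 'a \<Rightarrow> ereal" where
  "upper_local_dim M x = Limsup (at_right 0) (local_dim_ratio M x)"

definition upper_level_set :: "'a::metric_space set \<Rightarrow> 'a measure \<Rightarrow> real \<Rightarrow> 'a set" where
  "upper_level_set K M \<alpha> = {x \<in> K. upper_local_dim M x = ereal \<alpha>}"

definition level_set :: "'a::metric_space set \<Rightarrow> 'a measure \<Rightarrow> real \<Rightarrow> 'a set" where
  "level_set K M \<alpha> =
     {x \<in> K. lower_local_dim M x = ereal \<alpha> \<and> upper_local_dim M x = ereal \<alpha>}"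

text \<open>Families of compact subsets of \<open>K\<close> indexed by the open interval
  \<open>(0, packing_dim K)\<close>; the values of \<open>E\<close> at other reals are irrelevant.\<close>

definition increasing_compact_family :: "'a::metric_space set \<Rightarrow> (real \<Rightarrow> 'a set) \<Rightarrow> bool" where
  "increasing_compact_family K E \<longleftrightarrow>
     (\<forall>\<alpha>. 0 < \<alpha> \<and> ereal \<alpha> < packing_dim K \<longrightarrow> compact (E \<alpha>) \<and> E \<alpha> \<subseteq> K) \<and>
     (\<forall>\<alpha> \<beta>. 0 < \<alpha> \<and> \<alpha> \<le> \<beta> \<and> ereal \<beta> < packing_dim K \<longrightarrow> E \<alpha> \<subseteq> E \<beta>)"

end

theory Submission
  imports Defs
begin

text \<open>If \<open>packing_dim A < \<beta>\<close>, then \<open>A\<close> is a countable union of sets on which maximal packings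
  by balls of radius \<open>\<delta>\<close> have at most \<open>C * \<delta> powr - s\<close> elements for some \<open>s < \<beta>\<close>. Mixing
  the uniform distributions on their centres over dyadic \<open>\<delta>\<close> and over the pieces gives a discrete
  measure with \<open>\<mu> (cball x r) \<ge> c * r powr \<beta>\<close> for \<open>x \<in> A\<close> and small \<open>r\<close>. A further mixture over all
  rational \<open>\<alpha> < \<beta>\<close>, with \<open>A = E \<alpha>\<close>, has upper local dimension at most \<open>\<alpha>\<close> on every \<open>E \<alpha>\<close>,
  because the family is increasing. For any probability measure, the points of upper local dimension
  less than \<open>\<alpha>\<close> are null for the \<open>\<alpha>\<close>-dimensional packing measure, and those of lower local
  dimension less than \<open>\<alpha>\<close> are null for the \<open>\<alpha>\<close>-dimensional Hausdorff measure, so almost all of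
  \<open>E \<alpha>\<close> lies in the level set.\<close>

section \<open>Hausdorff and packing measures\<close>

text \<open>Both \<open>hausdorff_premeasure\<close> and \<open>packing_measure\<close> are infima
  of sums over countable covers, so the argument is given once, for any \<open>g\<close> and any
  class \<open>\<C>\<close> of admissible pieces. Covers of the sets \<open>A i\<close> that are
  optimal up to \<open>e / 2 ^ (i + 1)\<close> are merged into one, and the errors add up to
  \<open>e\<close>.\<close>

lemma INF_cover_suminf_subadditive:
  fixes g :: "'a set \<Rightarrow> ennreal" and \<C> :: "'a set set"
  defines "m \<equiv> \<lambda>A. INF U \<in> {U :: nat \<Rightarrow> 'a set. A \<subseteq> (\<Union>i. U i) \<and> (\<forall>i. U i \<in> \<C>)}. \<Sum>i. g (U i)"
  shows "m (\<Union>i::nat. A i) \<le> (\<Sum>i. m (A i))"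
proof (rule ennreal_le_epsilon)
  fix e :: real assume fin: "(\<Sum>i. m (A i)) < top" and e: "0 < e"
  have "\<exists>U. A i \<subseteq> (\<Union>j. U j) \<and> (\<forall>j. U j \<in> \<C>)
          \<and> (\<Sum>j. g (U j)) \<le> m (A i) + ennreal (e * (1/2) ^ Suc i)" for i
  proof -
    have "m (A i) \<noteq> \<infinity>"
      using ennreal_suminf_lessD[OF fin, of i] by auto
    then have "\<exists>U\<in>{U. A i \<subseteq> (\<Union>j. U j) \<and> (\<forall>j. U j \<in> \<C>)}.
        (\<Sum>j. g (U j)) < m (A i) + ennreal (e * (1/2) ^ Suc i)"
      using e unfolding m_def by (intro INF_approx_ennreal) auto
    then show ?thesis
      by (auto intro: less_imp_le)
  qed
  then obtain U where U: "\<And>i. A i \<subseteq> (\<Union>j. U i j)" "\<And>i j. U i j \<in> \<C>"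
    "\<And>i. (\<Sum>j. g (U i j)) \<le> m (A i) + ennreal (e * (1/2) ^ Suc i)"
    by metis
  define V where "V n = (case prod_decode n of (i, j) \<Rightarrow> U i j)" for n
  have "(\<Union>i. A i) \<subseteq> (\<Union>n. V n)"
  proof
    fix x assume "x \<in> (\<Union>i. A i)"
    then obtain i j where "x \<in> U i j"
      using U(1) by blast
    then have "x \<in> V (prod_encode (i, j))"
      by (simp add: V_def)
    then show "x \<in> (\<Union>n. V n)"
      by blast
  qed
  then have "m (\<Union>i. A i) \<le> (\<Sum>n. g (V n))"
    unfolding m_def using U(2) by (intro INF_lower) (auto simp: V_def split: prod.split)
  also have "\<dots> = (\<Sum>n. (\<lambda>(i, j). g (U i j)) (prod_decode n))"
    by (simp add: V_def case_prod_beta)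
  also have "\<dots> = (\<Sum>i. \<Sum>j. g (U i j))"
    by (rule suminf_ennreal_2dimen) simp
  also have "\<dots> \<le> (\<Sum>i. m (A i) + ennreal (e * (1/2) ^ Suc i))"
    by (intro suminf_le U) auto
  also have "\<dots> = (\<Sum>i. m (A i)) + (\<Sum>i. ennreal (e * (1/2) ^ Suc i))"
    by (intro suminf_add[symmetric]) auto
  also have "(\<Sum>i. ennreal (e * (1/2) ^ Suc i)) = ennreal (e * 1)"
    using e by (intro suminf_ennreal_eq sums_mult power_half_series) auto
  finally show "m (\<Union>i. A i) \<le> (\<Sum>i. m (A i)) + ennreal e"
    by simp
qed

lemma hausdorff_premeasure_UN_le:
  "hausdorff_premeasure s \<delta> (\<Union>i::nat. A i) \<le> (\<Sum>i. hausdorff_premeasure s \<delta> (A i))"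
  using INF_cover_suminf_subadditive
    [where \<C> = "{V. bounded V \<and> diameter V \<le> \<delta>}" and g = "diam_pow s" and A = A]
  unfolding hausdorff_premeasure_def mem_Collect_eq .

lemma packing_measure_UN_le:
  "packing_measure s (\<Union>i::nat. A i) \<le> (\<Sum>i. packing_measure s (A i))"
  using INF_cover_suminf_subadditive
    [where \<C> = UNIV and g = "packing_premeasure s" and A = A]
  unfolding packing_measure_def by simp

lemma hausdorff_premeasure_le_measure:
  "0 < \<delta> \<Longrightarrow> hausdorff_premeasure s \<delta> A \<le> hausdorff_measure s A"
  unfolding hausdorff_measure_def by (intro SUP_upper) auto

lemma hausdorff_measure_UN_le:
  "hausdorff_measure s (\<Union>i::nat. A i) \<le> (\<Sum>i. hausdorff_measure s (A i))"
  unfolding hausdorff_measure_def [of s "\<Union>i. A i"]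
proof (rule SUP_least)
  fix \<delta> :: real assume "\<delta> \<in> {0<..}"
  then show "hausdorff_premeasure s \<delta> (\<Union>i. A i) \<le> (\<Sum>i. hausdorff_measure s (A i))"
    by (intro order_trans[OF hausdorff_premeasure_UN_le] suminf_le hausdorff_premeasure_le_measure)
       auto
qed

section \<open>Monotonicity in the set and in the exponent\<close>

lemma hausdorff_premeasure_mono:
  "A \<subseteq> B \<Longrightarrow> hausdorff_premeasure s \<delta> A \<le> hausdorff_premeasure s \<delta> B"
  unfolding hausdorff_premeasure_def by (intro INF_superset_mono) auto

lemma hausdorff_measure_mono:
  "A \<subseteq> B \<Longrightarrow> hausdorff_measure s A \<le> hausdorff_measure s B"
  unfolding hausdorff_measure_def by (intro SUP_mono') (rule hausdorff_premeasure_mono)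

lemma packing_premeasure_at_mono:
  "A \<subseteq> B \<Longrightarrow> packing_premeasure_at s \<delta> A \<le> packing_premeasure_at s \<delta> B"
  unfolding packing_premeasure_at_def by (intro SUP_subset_mono) (auto simp: packings_def)

lemma packing_premeasure_mono:
  "A \<subseteq> B \<Longrightarrow> packing_premeasure s A \<le> packing_premeasure s B"
  unfolding packing_premeasure_def by (intro INF_mono') (rule packing_premeasure_at_mono)

lemma packing_measure_mono:
  "A \<subseteq> B \<Longrightarrow> packing_measure s A \<le> packing_measure s B"
  unfolding packing_measure_def by (intro INF_superset_mono) auto

text \<open>Powers of diameters at most 1 decrease as the exponent grows, and scales above 1 reduce
  to \<open>min \<delta> 1\<close> since a smaller \<open>\<delta>\<close> admits fewer
  covers.\<close>

lemma hausdorff_measure_eq_0_mono: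
  assumes "hausdorff_measure s A = 0" "0 \<le> s" "s \<le> t"
  shows "hausdorff_measure t A = 0"
proof -
  have small: "hausdorff_premeasure t \<delta> A = 0" if \<delta>: "0 < \<delta>" "\<delta> \<le> 1" for \<delta>
  proof -
    have "diam_pow t U \<le> diam_pow s U" if "bounded U" "diameter U \<le> \<delta>" for U :: "'a set"
    proof -
      have "0 \<le> diameter U" "diameter U \<le> 1"
        using that \<delta> diameter_ge_0 by force+
      \<comment> \<open>The second bound serves the case \<open>s = 0\<close>, where
        \<open>diam_pow\<close> of a non-empty set is 1 even if its diameter is 0.\<close>
      then have "diameter U powr t \<le> diameter U powr s" "diameter U powr t \<le> 1"
        using assms by (auto intro: powr_mono' powr_le1)
      then show ?thesis
        using assms by (auto simp: diam_pow_def intro: ennreal_leI)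
    qed
    then have "hausdorff_premeasure t \<delta> A \<le> hausdorff_premeasure s \<delta> A"
      unfolding hausdorff_premeasure_def by (intro INF_mono) (auto intro!: suminf_le bexI)
    also have "\<dots> \<le> 0"
      using hausdorff_premeasure_le_measure[of \<delta> s A] assms \<delta> by simp
    finally show ?thesis by simp
  qed
  have "hausdorff_premeasure t \<delta> A = 0" if "0 < \<delta>" for \<delta>
  proof -
    have "hausdorff_premeasure t \<delta> A \<le> hausdorff_premeasure t (min \<delta> 1) A"
      unfolding hausdorff_premeasure_def by (intro INF_superset_mono) auto
    then show ?thesis
      using small[of "min \<delta> 1"] that by simp
  qed
  then show ?thesis
    unfolding hausdorff_measure_def by simp
qed

lemma packing_premeasure_at_mono_radius:
  "\<delta> \<le> \<delta>' \<Longrightarrow> packing_premeasure_at s \<delta> A \<le> packing_premeasure_at s \<delta>' A"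
  unfolding packing_premeasure_at_def by (intro SUP_subset_mono) (auto simp: packings_def)

lemma packing_premeasure_antimono:
  assumes "s \<le> t"
  shows "packing_premeasure t A \<le> packing_premeasure s A"
  unfolding packing_premeasure_def [of s]
proof (rule INF_greatest)
  fix \<delta> :: real assume "\<delta> \<in> {0<..}"
  \<comment> \<open>Radii at most 1/2 keep the bases \<open>2 * r\<close> at most 1, where powers
    decrease in the exponent.\<close>
  then have "packing_premeasure t A \<le> packing_premeasure_at t (min \<delta> (1/2)) A"
    unfolding packing_premeasure_def by (intro INF_lower) auto
  also have "\<dots> \<le> packing_premeasure_at s (min \<delta> (1/2)) A"
    unfolding packing_premeasure_at_def
  proof (rule SUP_subset_mono[OF order_refl])
    fix F assume F: "F \<in> packings (min \<delta> (1/2)) A"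
    have "(2 * r) powr t \<le> (2 * r) powr s" if "(x, r) \<in> F" for x r
      using F that assms by (intro powr_mono') (auto simp: packings_def)
    then show "(\<Sum>\<^sub>\<infinity>(x, r)\<in>F. ennreal ((2 * r) powr t)) \<le> (\<Sum>\<^sub>\<infinity>(x, r)\<in>F. ennreal ((2 * r) powr s))"
      by (intro infsum_mono nonneg_summable_on_complete) (auto intro: ennreal_leI)
  qed
  also have "\<dots> \<le> packing_premeasure_at s \<delta> A"
    by (intro packing_premeasure_at_mono_radius) simp
  finally show "packing_premeasure t A \<le> packing_premeasure_at s \<delta> A" .
qed

lemma packing_measure_antimono: "s \<le> t \<Longrightarrow> packing_measure t A \<le> packing_measure s A"
  unfolding packing_measure_def
  by (intro INF_mono') (auto intro!: suminf_le packing_premeasure_antimono)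

section \<open>Covers obtained from packings, and comparison of the two measures\<close>

text \<open>Take a packing by balls of the single radius \<open>\<rho>\<close> with the largest
  number of centres: a point further than \<open>2 * \<rho>\<close> from every centre could be added
  to it. Finiteness of the premeasure bounds the number of centres, so a largest packing
  exists.\<close>

lemma packing_premeasure_finite_cover:
  assumes fin: "packing_premeasure_at s \<delta> U < \<infinity>" and \<rho>: "0 < \<rho>" "\<rho> \<le> \<delta>"
  obtains S where "finite S" "S \<subseteq> U" "U \<subseteq> (\<Union>x\<in>S. cball x (2 * \<rho>))"
    "of_nat (card S) * ennreal ((2 * \<rho>) powr s) \<le> packing_premeasure_at s \<delta> U"
proof -
  define P where "P S \<longleftrightarrow> finite S \<and> S \<subseteq> U \<and> disjoint_family_on (\<lambda>x. cball x \<rho>) S" for S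
  have card: "of_nat (card S) * ennreal ((2 * \<rho>) powr s) \<le> packing_premeasure_at s \<delta> U"
    if "P S" for S
  proof -
    let ?F = "(\<lambda>x. (x, \<rho>)) ` S"
    have "?F \<in> packings \<delta> U"
      using that \<rho> by (auto simp: packings_def P_def disjoint_family_on_def intro: countable_finite)
    then have "(\<Sum>\<^sub>\<infinity>(x, r)\<in>?F. ennreal ((2 * r) powr s)) \<le> packing_premeasure_at s \<delta> U"
      unfolding packing_premeasure_at_def by (rule SUP_upper)
    moreover have "(\<Sum>\<^sub>\<infinity>(x, r)\<in>?F. ennreal ((2 * r) powr s)) = of_nat (card S) * ennreal ((2 * \<rho>) powr s)"
      using that by (simp add: P_def sum.reindex inj_on_def)
    ultimately show ?thesis
      by simp
  qed
  define c where "c = enn2real (packing_premeasure_at s \<delta> U) / (2 * \<rho>) powr s"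
  have "card S \<le> nat \<lfloor>c\<rfloor>" if "P S" for S
  proof -
    have "ennreal (real (card S) * (2 * \<rho>) powr s) \<le> packing_premeasure_at s \<delta> U"
      using card[OF that] by (simp add: ennreal_mult ennreal_of_nat_eq_real_of_nat)
    then have "real (card S) * (2 * \<rho>) powr s \<le> enn2real (packing_premeasure_at s \<delta> U)"
      using fin enn2real_mono by fastforce
    then have "real (card S) \<le> c"
      using \<rho> by (simp add: c_def field_simps)
    then show ?thesis
      by linarith
  qed
  moreover have "P {}"
    by (simp add: P_def disjoint_family_on_def)
  ultimately have "\<exists>S. P S \<and> (\<forall>T. P T \<longrightarrow> card T \<le> card S)"
    by (intro ex_has_greatest_nat[where b = "Suc (nat \<lfloor>c\<rfloor>)"]) (auto simp: less_Suc_eq_le)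
  then obtain S where S: "P S" and max: "\<And>T. P T \<Longrightarrow> card T \<le> card S"
    by auto
  have "U \<subseteq> (\<Union>x\<in>S. cball x (2 * \<rho>))"
  proof
    fix y assume "y \<in> U"
    show "y \<in> (\<Union>x\<in>S. cball x (2 * \<rho>))"
    proof (rule ccontr)
      assume "y \<notin> (\<Union>x\<in>S. cball x (2 * \<rho>))"
      then have far: "2 * \<rho> < dist x y" if "x \<in> S" for x
        using that by auto
      then have "y \<notin> S"
        using \<rho> by force
      moreover have "cball x \<rho> \<inter> cball y \<rho> = {}" if "x \<in> S" for x
      proof -
        have False if "dist x z \<le> \<rho>" "dist y z \<le> \<rho>" for z
          using far[OF \<open>x \<in> S\<close>] dist_triangle2[of x y z] that by linarith
        then show ?thesis
          by auto
      qed
      ultimately have "P (insert y S)"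
        using S \<open>y \<in> U\<close> by (auto simp: P_def disjoint_family_on_insert)
      then have "card (insert y S) \<le> card S"
        by (rule max)
      then show False
        using \<open>y \<notin> S\<close> S by (simp add: P_def)
    qed
  qed
  then show ?thesis
    using that[of S] S card[OF S] by (simp add: P_def)
qed

text \<open>An enumeration of \<open>C\<close> padded with empty sets, whose \<open>diam_pow\<close>
  is 0, is a cover of the form that the definition asks for. The hypothesis \<open>sum\<close>
  speaks of finite subfamilies only, as this is the form in which counting and disjointness bounds
  arise.\<close>

lemma hausdorff_premeasure_le_countable_cover:
  assumes "countable C" "A \<subseteq> (\<Union>c\<in>C. V c)"
    and V: "\<And>c. c \<in> C \<Longrightarrow> bounded (V c) \<and> diameter (V c) \<le> \<delta>" and "0 \<le> \<delta>"
    and sum: "\<And>F. finite F \<Longrightarrow> F \<subseteq> C \<Longrightarrow> (\<Sum>c\<in>F. diam_pow s (V c)) \<le> b"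
  shows "hausdorff_premeasure s \<delta> A \<le> b"
proof -
  define U where "U n = (if n \<in> to_nat_on C ` C then V (from_nat_into C n) else {})" for n
  have U: "U (to_nat_on C c) = V c" if "c \<in> C" for c
    using that assms(1) by (simp add: U_def)
  have "A \<subseteq> (\<Union>n. U n)"
  proof
    fix x assume "x \<in> A"
    then obtain c where "c \<in> C" "x \<in> V c"
      using assms(2) by blast
    then show "x \<in> (\<Union>n. U n)"
      using U[of c] by (intro UN_I[of "to_nat_on C c"]) auto
  qed
  moreover have "bounded (U n) \<and> diameter (U n) \<le> \<delta>" for n
    using V \<open>countable C\<close> \<open>0 \<le> \<delta>\<close> by (auto simp: U_def)
  ultimately have "hausdorff_premeasure s \<delta> A \<le> (\<Sum>n. diam_pow s (U n))"
    unfolding hausdorff_premeasure_def by (intro INF_lower) auto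
  also have "\<dots> \<le> b"
  proof (rule suminf_le_const)
    fix n
    define F where "F = {c \<in> C. to_nat_on C c < n}"
    have inj: "inj_on (to_nat_on C) F"
      using inj_on_to_nat_on[OF \<open>countable C\<close>] by (rule inj_on_subset) (auto simp: F_def)
    have "(\<Sum>i<n. diam_pow s (U i)) = (\<Sum>i\<in>to_nat_on C ` F. diam_pow s (U i))"
      by (rule sum.mono_neutral_right) (auto simp: F_def U_def diam_pow_def)
    also have "\<dots> = (\<Sum>c\<in>F. diam_pow s (V c))"
      using inj U by (subst sum.reindex) (auto simp: F_def)
    also have "\<dots> \<le> b"
    proof (rule sum)
      show "finite F"
        using inj by (rule inj_on_finite[where B = "{..<n}"]) (auto simp: F_def)
    qed (auto simp: F_def)
    finally show "(\<Sum>i<n. diam_pow s (U i)) \<le> b" .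
  qed simp
  finally show ?thesis .
qed

text \<open>Multiplication by a finite positive constant is invertible on \<open>ennreal\<close>, so
  it can be moved across the infimum.\<close>

lemma ennreal_mult_INF_greatest:
  assumes "0 < c" "\<And>i. i \<in> I \<Longrightarrow> x \<le> ennreal c * f i"
  shows "x \<le> ennreal c * (INF i\<in>I. f i)"
proof -
  have inv: "ennreal c * (ennreal (1 / c) * y) = y" "ennreal (1 / c) * (ennreal c * y) = y" for y
    using assms(1) by (simp_all flip: mult.assoc ennreal_mult)
  have "ennreal (1 / c) * x \<le> (INF i\<in>I. f i)"
  proof (rule INF_greatest)
    fix i assume "i \<in> I"
    then have "ennreal (1 / c) * x \<le> ennreal (1 / c) * (ennreal c * f i)"
      by (intro mult_left_mono assms) auto
    then show "ennreal (1 / c) * x \<le> f i"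
      by (simp only: inv)
  qed
  then have "ennreal c * (ennreal (1 / c) * x) \<le> ennreal c * (INF i\<in>I. f i)"
    by (rule mult_left_mono) simp
  then show ?thesis
    by (simp only: inv)
qed

text \<open>The balls of radius \<open>2 * \<rho>\<close> around the centres of a largest packing
  cover \<open>U\<close> and have diameter \<open>4 * \<rho>\<close>, twice the size
  \<open>2 * \<rho>\<close> that enters the packing sum. This accounts for the factor
  \<open>2 powr t\<close>.\<close>

lemma hausdorff_measure_le_packing_premeasure:
  fixes U :: "'a::euclidean_space set"
  assumes "0 < t"
  shows "hausdorff_measure t U \<le> ennreal (2 powr t) * packing_premeasure t U"
proof -
  have "hausdorff_premeasure t \<eta> U \<le> ennreal (2 powr t) * packing_premeasure_at t \<delta> U"
    if "0 < \<eta>" "0 < \<delta>" for \<eta> \<delta>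
  proof (cases "packing_premeasure_at t \<delta> U < \<infinity>")
    case True
    \<comment> \<open>Small enough for the packing scale \<open>\<delta>\<close> and, after
      enlargement, for the covering scale \<open>\<eta>\<close>.\<close>
    define \<rho> where "\<rho> = min \<delta> (\<eta> / 4)"
    have \<rho>: "0 < \<rho>" "\<rho> \<le> \<delta>" "4 * \<rho> \<le> \<eta>"
      using that by (auto simp: \<rho>_def)
    obtain S where S: "finite S" "U \<subseteq> (\<Union>x\<in>S. cball x (2 * \<rho>))"
      and card: "of_nat (card S) * ennreal ((2 * \<rho>) powr t) \<le> packing_premeasure_at t \<delta> U"
      using packing_premeasure_finite_cover[OF True \<rho>(1,2)] by metis
    show ?thesis
    proof (rule hausdorff_premeasure_le_countable_cover[OF countable_finite[OF S(1)] S(2)])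
      fix F assume F: "finite F" "F \<subseteq> S"
      have "(\<Sum>x\<in>F. diam_pow t (cball x (2 * \<rho>))) = of_nat (card F) * ennreal ((4 * \<rho>) powr t)"
        using \<rho> assms by (simp add: diam_pow_def)
      also have "\<dots> \<le> of_nat (card S) * ennreal ((4 * \<rho>) powr t)"
        using F S by (intro mult_right_mono) (auto intro: card_mono)
      also have "(4 * \<rho>) powr t = 2 powr t * (2 * \<rho>) powr t"
        using \<rho> by (simp flip: powr_mult)
      also have "of_nat (card S) * ennreal (2 powr t * (2 * \<rho>) powr t)
          = ennreal (2 powr t) * (of_nat (card S) * ennreal ((2 * \<rho>) powr t))"
        by (simp add: ennreal_mult ac_simps)
      also have "\<dots> \<le> ennreal (2 powr t) * packing_premeasure_at t \<delta> U"
        using card by (intro mult_left_mono) auto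
      finally show "(\<Sum>x\<in>F. diam_pow t (cball x (2 * \<rho>)))
          \<le> ennreal (2 powr t) * packing_premeasure_at t \<delta> U" .
    qed (use \<rho> that in auto)
  next
    case False
    then have "packing_premeasure_at t \<delta> U = top"
      by (simp add: not_less top_unique)
    then show ?thesis
      by (simp add: ennreal_mult_top)
  qed
  then show ?thesis
    unfolding hausdorff_measure_def packing_premeasure_def
    by (intro SUP_least ennreal_mult_INF_greatest) auto
qed

text \<open>The bound by the premeasure is summed over a countable cover of \<open>A\<close>, which
  is possible because the Hausdorff measure on the left is countably subadditive.\<close>

lemma hausdorff_measure_le_packing_measure:
  fixes A :: "'a::euclidean_space set"
  assumes "0 < t"
  shows "hausdorff_measure t A \<le> ennreal (2 powr t) * packing_measure t A"
proof -
  have "hausdorff_measure t A \<le> ennreal (2 powr t) * (\<Sum>i. packing_premeasure t (U i))"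
    if "A \<subseteq> (\<Union>i. U i)" for U :: "nat \<Rightarrow> _"
  proof -
    have "hausdorff_measure t A \<le> hausdorff_measure t (\<Union>i. U i)"
      by (rule hausdorff_measure_mono[OF that])
    also have "\<dots> \<le> (\<Sum>i. hausdorff_measure t (U i))"
      by (rule hausdorff_measure_UN_le)
    also have "\<dots> \<le> (\<Sum>i. ennreal (2 powr t) * packing_premeasure t (U i))"
      by (intro suminf_le hausdorff_measure_le_packing_premeasure assms) auto
    finally show ?thesis
      by simp
  qed
  then show ?thesis
    unfolding packing_measure_def by (intro ennreal_mult_INF_greatest) auto
qed

section \<open>Bounds for the dimensions from null and non-null measures\<close>

lemma packing_dim_leI:
  assumes "0 \<le> \<alpha>" "\<And>t. \<alpha> < t \<Longrightarrow> packing_measure t A = 0"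
  shows "packing_dim A \<le> ereal \<alpha>"
proof (rule ccontr)
  assume "\<not> packing_dim A \<le> ereal \<alpha>"
  then obtain t where t: "ereal \<alpha> < ereal t" "ereal t < packing_dim A"
    using ereal_dense2[of "ereal \<alpha>" "packing_dim A"] by (auto simp: not_le)
  then have "packing_dim A \<le> ereal t"
    unfolding packing_dim_def using assms by (intro INF_lower) auto
  then show False
    using t by simp
qed

lemma hausdorff_dim_leI:
  assumes "0 \<le> \<alpha>" "\<And>t. \<alpha> < t \<Longrightarrow> hausdorff_measure t A = 0"
  shows "hausdorff_dim A \<le> ereal \<alpha>"
proof (rule ccontr)
  assume "\<not> hausdorff_dim A \<le> ereal \<alpha>"
  then obtain t where t: "ereal \<alpha> < ereal t" "ereal t < hausdorff_dim A"
    using ereal_dense2[of "ereal \<alpha>" "hausdorff_dim A"] by (auto simp: not_le)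
  then have "hausdorff_dim A \<le> ereal t"
    unfolding hausdorff_dim_def using assms by (intro INF_lower) auto
  then show False
    using t by simp
qed

lemma packing_dim_geI:
  assumes "packing_measure \<alpha> A \<noteq> 0"
  shows "ereal \<alpha> \<le> packing_dim A"
  unfolding packing_dim_def
proof (rule INF_greatest)
  fix s assume "s \<in> {s. 0 \<le> s \<and> packing_measure s A = 0}"
  then have "\<not> s \<le> \<alpha>"
    using assms packing_measure_antimono[of s \<alpha> A] by auto
  then show "ereal \<alpha> \<le> ereal s"
    by simp
qed

lemma hausdorff_dim_geI:
  assumes "hausdorff_measure \<alpha> A \<noteq> 0"
  shows "ereal \<alpha> \<le> hausdorff_dim A"
  unfolding hausdorff_dim_def
proof (rule INF_greatest)
  fix s assume "s \<in> {s. 0 \<le> s \<and> hausdorff_measure s A = 0}"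
  then have "\<not> s \<le> \<alpha>"
    using assms hausdorff_measure_eq_0_mono[of s A \<alpha>] by auto
  then show "ereal \<alpha> \<le> ereal s"
    by simp
qed

section \<open>Local dimensions\<close>

text \<open>The mass inside \<open>local_dim_ratio\<close>, named so that local dimensions can be
  handled by comparing it with powers of \<open>r\<close>.\<close>

definition ball_mass :: "'a::metric_space measure \<Rightarrow> 'a \<Rightarrow> real \<Rightarrow> real" where
  "ball_mass M x r = measure M (cball x r \<inter> space M)"

text \<open>For \<open>r < 1\<close> the division by \<open>ln r\<close> reverses inequalities. A
  ball of mass 0 is excluded: its ratio is -\<infinity> divided by a negative number, hence
  \<infinity>.\<close>

lemma powr_le_ball_mass_if_ratio_less:
  assumes "0 < r" "r < 1" "local_dim_ratio M x r < ereal s"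
  shows "r powr s \<le> ball_mass M x r"
proof -
  have ln: "ln r < 0"
    using assms by simp
  have pos: "0 < ball_mass M x r"
  proof (rule ccontr)
    assume "\<not> 0 < ball_mass M x r"
    then have "ball_mass M x r = 0"
      by (simp add: ball_mass_def zero_less_measure_iff)
    then have "local_dim_ratio M x r = - \<infinity> / ereal (ln r)"
      by (simp add: local_dim_ratio_def ext_ln_def ball_mass_def)
    then have "local_dim_ratio M x r = \<infinity>"
      using ln by (simp add: divide_ereal_def)
    then show False
      using assms by simp
  qed
  then have "local_dim_ratio M x r = ereal (ln (ball_mass M x r) / ln r)"
    using ln by (simp add: local_dim_ratio_def ext_ln_def ball_mass_def)
  then have "s * ln r < ln (ball_mass M x r)"
    using assms ln by (simp add: divide_less_eq)
  then have "exp (s * ln r) \<le> exp (ln (ball_mass M x r))"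
    by simp
  then show ?thesis
    using pos assms by (simp add: powr_def)
qed

lemma ratio_le_if_powr_le_ball_mass:
  assumes "0 < r" "r < 1" "r powr s \<le> ball_mass M x r"
  shows "local_dim_ratio M x r \<le> ereal s"
proof -
  have ln: "ln r < 0"
    using assms by simp
  have pos: "0 < ball_mass M x r"
    using assms by (smt (verit) powr_gt_zero)
  then have "local_dim_ratio M x r = ereal (ln (ball_mass M x r) / ln r)"
    using ln by (simp add: local_dim_ratio_def ext_ln_def ball_mass_def)
  moreover have "s * ln r \<le> ln (ball_mass M x r)"
    using assms pos ln_mono[of "r powr s" "ball_mass M x r"] by (simp add: ln_powr)
  ultimately show ?thesis
    using ln by (simp add: divide_le_eq)
qed

lemma eventually_powr_le_ball_mass:
  assumes "upper_local_dim M x < ereal s"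
  shows "\<forall>\<^sub>F r in at_right 0. r powr s \<le> ball_mass M x r"
  using Limsup_lessD[OF assms[unfolded upper_local_dim_def]]
    eventually_at_right_real[of 0 1, OF zero_less_one]
  by eventually_elim (auto intro: powr_le_ball_mass_if_ratio_less)

text \<open>A limit inferior controls only some arbitrarily small radii, whereas the limit superior
  controls all small ones. This difference decides which measure is governed by which local
  dimension: packings need all small radii, covers only some.\<close>

lemma frequently_powr_le_ball_mass:
  assumes "lower_local_dim M x < ereal s"
  shows "\<exists>\<^sub>F r in at_right 0. r powr s \<le> ball_mass M x r"
proof -
  have "\<exists>\<^sub>F r in at_right 0. local_dim_ratio M x r < ereal s"
  proof (rule ccontr)
    assume "\<not> ?thesis"
    then have "\<forall>\<^sub>F r in at_right 0. ereal s \<le> local_dim_ratio M x r"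
      by (simp add: frequently_def not_less)
    then have "ereal s \<le> lower_local_dim M x"
      unfolding lower_local_dim_def by (rule Liminf_bounded)
    then show False
      using assms by simp
  qed
  from frequently_eventually_frequently[OF this eventually_at_right_real[of 0 1, OF zero_less_one]]
  show ?thesis
    by (rule frequently_elim1) (auto intro: powr_le_ball_mass_if_ratio_less)
qed

lemma upper_local_dim_leI:
  assumes "\<And>s. \<alpha> < s \<Longrightarrow> \<forall>\<^sub>F r in at_right 0. r powr s \<le> ball_mass M x r"
  shows "upper_local_dim M x \<le> ereal \<alpha>"
proof (rule ccontr)
  assume "\<not> upper_local_dim M x \<le> ereal \<alpha>"
  then obtain s where s: "ereal \<alpha> < ereal s" "ereal s < upper_local_dim M x"
    using ereal_dense2[of "ereal \<alpha>" "upper_local_dim M x"] by (auto simp: not_le)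
  have "\<forall>\<^sub>F r in at_right 0. r powr s \<le> ball_mass M x r"
    using assms s(1) by simp
  then have "\<forall>\<^sub>F r in at_right 0. local_dim_ratio M x r \<le> ereal s"
    using eventually_at_right_real[of 0 1, OF zero_less_one]
    by eventually_elim (auto intro: ratio_le_if_powr_le_ball_mass)
  then have "upper_local_dim M x \<le> ereal s"
    unfolding upper_local_dim_def by (rule Limsup_bounded)
  then show False
    using s by simp
qed

lemma lower_local_dim_le_upper: "lower_local_dim M x \<le> upper_local_dim M x"
  unfolding lower_local_dim_def upper_local_dim_def by (rule Liminf_le_Limsup) simp

section \<open>Sets on which small balls are heavy are null\<close>

text \<open>Disjoint balls share a total mass of 1. This bounds the sums over packings and, later,
  over the disjoint balls of a Vitali family.\<close>

lemma sum_ball_mass_le_1: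
  assumes M: "M \<in> borel_prob_measures K" and "finite F"
    and "disjoint_family_on (\<lambda>(x, r). cball x r) F"
  shows "(\<Sum>(x, r)\<in>F. ball_mass M x r) \<le> 1"
proof -
  interpret prob_space M
    using M by (simp add: borel_prob_measures_def)
  have sets: "sets M = sets (restrict_space borel K)"
    using M by (simp add: borel_prob_measures_def)
  have ball: "cball x r \<inter> space M \<in> sets M" for x r
    using sets sets_eq_imp_space_eq[OF sets]
    by (simp add: space_restrict_space sets_restrict_space Int_commute)
  have "(\<Sum>(x, r)\<in>F. ball_mass M x r) = (\<Sum>p\<in>F. measure M (cball (fst p) (snd p) \<inter> space M))"
    by (simp add: ball_mass_def case_prod_beta)
  also have "\<dots> = measure M (\<Union>p\<in>F. cball (fst p) (snd p) \<inter> space M)"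
  proof (rule finite_measure_finite_Union[symmetric])
    show "disjoint_family_on (\<lambda>p. cball (fst p) (snd p) \<inter> space M) F"
      using assms(3) unfolding disjoint_family_on_def case_prod_beta by blast
  qed (use assms(2) ball in auto)
  finally show ?thesis
    by simp
qed

lemma eventually_mult_powr_less:
  assumes "0 < a" "0 < e"
  shows "\<forall>\<^sub>F x in at_right (0::real). c * x powr a < e"
proof -
  have "((\<lambda>x::real. x powr a) \<longlongrightarrow> 0) (at_right 0)"
    using assms by (intro tendsto_zero_powrI[where b = a] tendsto_ident_at tendsto_const)
      (auto simp: eventually_at_right_less eventually_at_filter)
  then have "((\<lambda>x::real. c * x powr a) \<longlongrightarrow> c * 0) (at_right 0)"
    by (intro tendsto_mult_left)
  then show ?thesis
    using assms by (intro order_tendstoD(2)) auto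
qed

text \<open>Raising the exponent from \<open>s\<close> to \<open>t\<close> gains the factor
  \<open>\<delta> powr (t - s)\<close>, which tends to 0 with \<open>\<delta>\<close> and makes the
  sums below vanish.\<close>

lemma powr_le_powr_diff_mult:
  assumes "0 < r" "r \<le> \<delta>" "s < t" "r powr s \<le> m"
  shows "r powr t \<le> \<delta> powr (t - s) * (m::real)"
proof -
  have "r powr t = r powr (t - s) * r powr s"
    by (simp flip: powr_add)
  also have "\<dots> \<le> \<delta> powr (t - s) * m"
    using assms by (intro mult_mono powr_mono2) auto
  finally show ?thesis .
qed

text \<open>One threshold \<open>b\<close> serves all points of \<open>A\<close>, as a packing is
  free to choose its radii. Each term of a packing sum is then at most
  \<open>2 powr t * \<delta> powr (t - s)\<close> times the mass of its ball, the masses add up to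
  at most 1, and \<open>\<delta>\<close> tends to 0.\<close>

lemma packing_premeasure_eq_0:
  assumes M: "M \<in> borel_prob_measures K" and st: "s < t" and b: "0 < b"
    and A: "\<And>x r. x \<in> A \<Longrightarrow> 0 < r \<Longrightarrow> r < b \<Longrightarrow> r powr s \<le> ball_mass M x r"
  shows "packing_premeasure t A = 0"
proof -
  have at: "packing_premeasure_at t \<delta> A \<le> ennreal (2 powr t * \<delta> powr (t - s))"
    if \<delta>: "0 < \<delta>" "\<delta> < b" for \<delta>
    unfolding packing_premeasure_at_def
  proof (rule SUP_least)
    fix F assume F: "F \<in> packings \<delta> A"
    show "(\<Sum>\<^sub>\<infinity>(x, r)\<in>F. ennreal ((2 * r) powr t)) \<le> ennreal (2 powr t * \<delta> powr (t - s))"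
    proof (rule infsum_le_finite_sums)
      fix G assume G: "finite G" "G \<subseteq> F"
      have "(2 * r) powr t \<le> 2 powr t * \<delta> powr (t - s) * ball_mass M x r" if "(x, r) \<in> G" for x r
        using powr_le_powr_diff_mult[of r \<delta> s t "ball_mass M x r"] A[of x r] F G that \<delta> st
        by (auto simp: packings_def powr_mult)
      then have "(\<Sum>(x, r)\<in>G. (2 * r) powr t)
          \<le> (\<Sum>(x, r)\<in>G. 2 powr t * \<delta> powr (t - s) * ball_mass M x r)"
        by (intro sum_mono) auto
      also have "\<dots> = 2 powr t * \<delta> powr (t - s) * (\<Sum>(x, r)\<in>G. ball_mass M x r)"
        by (simp add: sum_distrib_left case_prod_beta)
      also have "\<dots> \<le> 2 powr t * \<delta> powr (t - s) * 1"
      proof (intro mult_left_mono sum_ball_mass_le_1[OF M])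
        show "disjoint_family_on (\<lambda>(x, r). cball x r) G"
          using F G(2) unfolding packings_def by (blast intro: disjoint_family_on_mono)
      qed (use G in auto)
      finally show "(\<Sum>(x, r)\<in>G. ennreal ((2 * r) powr t)) \<le> ennreal (2 powr t * \<delta> powr (t - s))"
        by (simp add: case_prod_beta sum_ennreal ennreal_leI)
    qed (rule nonneg_summable_on_complete, simp)
  qed
  have "packing_premeasure t A \<le> 0 + ennreal e" if "0 < e" for e
  proof -
    have "\<forall>\<^sub>F \<delta> in at_right 0. 2 powr t * \<delta> powr (t - s) < e \<and> 0 < \<delta> \<and> \<delta> < b"
      using eventually_mult_powr_less[of "t - s" e "2 powr t"] eventually_at_right_real[of 0 b] st that b
      by (auto intro: eventually_conj)
    then obtain \<delta> where \<delta>: "2 powr t * \<delta> powr (t - s) < e" "0 < \<delta>" "\<delta> < b"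
      using eventually_happens'[of "at_right (0::real)"] by auto
    have "packing_premeasure t A \<le> packing_premeasure_at t \<delta> A"
      unfolding packing_premeasure_def using \<delta> by (intro INF_lower) auto
    also have "\<dots> \<le> ennreal e"
      using \<delta> by (intro order_trans[OF at ennreal_leI]) auto
    finally show ?thesis by simp
  qed
  then have "packing_premeasure t A \<le> 0"
    by (rule ennreal_le_epsilon)
  then show ?thesis
    by simp
qed

text \<open>The threshold for \<open>r\<close> varies with the point. Sorting the points by
  thresholds \<open>1 / (n + 1)\<close> gives countably many sets with a uniform one, and the
  definition of the packing measure allows such a cover.\<close>

lemma packing_measure_eq_0_if_eventually:
  assumes M: "M \<in> borel_prob_measures K" and st: "s < t"
    and A: "\<And>x. x \<in> A \<Longrightarrow> \<forall>\<^sub>F r in at_right 0. r powr s \<le> ball_mass M x r"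
  shows "packing_measure t A = 0"
proof -
  define B where "B n = {x \<in> A. \<forall>r. 0 < r \<and> r < 1 / real (Suc n) \<longrightarrow> r powr s \<le> ball_mass M x r}" for n
  have "A \<subseteq> (\<Union>n. B n)"
  proof
    fix x assume "x \<in> A"
    with A[of x] obtain b where b: "0 < b" "\<And>r. 0 < r \<Longrightarrow> r < b \<Longrightarrow> r powr s \<le> ball_mass M x r"
      by (auto simp: eventually_at_right_field)
    then obtain n where "1 / real (Suc n) < b"
      using nat_approx_posE by blast
    then have "x \<in> B n"
      using b \<open>x \<in> A\<close> by (force simp: B_def)
    then show "x \<in> (\<Union>n. B n)"
      by blast
  qed
  then have "packing_measure t A \<le> (\<Sum>n. packing_premeasure t (B n))"
    unfolding packing_measure_def by (intro INF_lower) auto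
  also have "packing_premeasure t (B n) = 0" for n
    by (rule packing_premeasure_eq_0[OF M st, of "1 / real (Suc n)"]) (auto simp: B_def)
  then have "(\<Sum>n. packing_premeasure t (B n)) = 0"
    by simp
  finally show ?thesis
    by simp
qed

text \<open>One good radius below each scale is enough, since a cover may choose its radii. The
  Vitali covering lemma extracts from the good balls a countable disjoint family whose fivefold
  enlargements still cover \<open>A\<close>.\<close>

lemma hausdorff_measure_eq_0_if_frequently:
  fixes A :: "'a::euclidean_space set"
  assumes M: "M \<in> borel_prob_measures K" and st: "s < t" "0 < t"
    and A: "\<And>x. x \<in> A \<Longrightarrow> \<exists>\<^sub>F r in at_right 0. r powr s \<le> ball_mass M x r"
  shows "hausdorff_measure t A = 0"
proof -
  have "hausdorff_premeasure t \<eta> A \<le> 0 + ennreal e" if "0 < e" "0 < \<eta>" for e \<eta>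
  proof -
    \<comment> \<open>A ball of radius \<open>r\<close> enlarged five times has diameter
      \<open>10 * r\<close>, hence the constant 10 and the bound \<open>\<eta> / 10\<close>.\<close>
    have "\<forall>\<^sub>F \<delta> in at_right 0. 10 powr t * \<delta> powr (t - s) < e \<and> 0 < \<delta> \<and> \<delta> < \<eta> / 10"
      using eventually_mult_powr_less[of "t - s" e "10 powr t"]
        eventually_at_right_real[of 0 "\<eta> / 10"] st that
      by (auto intro: eventually_conj)
    then obtain \<delta> where \<delta>: "10 powr t * \<delta> powr (t - s) < e" "0 < \<delta>" "\<delta> < \<eta> / 10"
      using eventually_happens'[of "at_right (0::real)"] by auto
    define I where "I = {(x, r). x \<in> A \<and> 0 < r \<and> r < \<delta> \<and> r powr s \<le> ball_mass M x r}"
    have "A \<subseteq> (\<Union>i\<in>I. cball (fst i) (snd i))"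
    proof
      fix x assume "x \<in> A"
      from frequently_eventually_frequently[OF A[OF this] eventually_at_right_real[OF \<delta>(2)]]
      obtain r where "r powr s \<le> ball_mass M x r" "0 < r" "r < \<delta>"
        by (auto dest: frequently_ex)
      with \<open>x \<in> A\<close> have "(x, r) \<in> I"
        by (simp add: I_def)
      then show "x \<in> (\<Union>i\<in>I. cball (fst i) (snd i))"
        using \<open>0 < r\<close> by force
    qed
    moreover have "0 < snd i \<and> snd i \<le> \<delta>" if "i \<in> I" for i
      using that by (auto simp: I_def)
    ultimately obtain C where C: "countable C" "C \<subseteq> I"
        "pairwise (\<lambda>i j. disjnt (cball (fst i) (snd i)) (cball (fst j) (snd j))) C"
        "A \<subseteq> (\<Union>i\<in>C. cball (fst i) (5 * snd i))"
      by (rule Vitali_covering_lemma_cballs)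
    show ?thesis
    proof (rule hausdorff_premeasure_le_countable_cover[OF C(1,4)])
      fix i assume "i \<in> C"
      then show "bounded (cball (fst i) (5 * snd i)) \<and> diameter (cball (fst i) (5 * snd i)) \<le> \<eta>"
        using C(2) \<delta> by (auto simp: I_def)
    next
      fix F assume F: "finite F" "F \<subseteq> C"
      have bd: "diam_pow t (cball (fst i) (5 * snd i))
          \<le> ennreal (10 powr t * \<delta> powr (t - s) * ball_mass M (fst i) (snd i))" if "i \<in> F" for i
      proof -
        have i: "0 < snd i" "snd i < \<delta>" "snd i powr s \<le> ball_mass M (fst i) (snd i)"
          using F C(2) that by (auto simp: I_def)
        then have "(10 * snd i) powr t \<le> 10 powr t * \<delta> powr (t - s) * ball_mass M (fst i) (snd i)"
          using powr_le_powr_diff_mult[of "snd i" \<delta> s t "ball_mass M (fst i) (snd i)"] st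
          by (simp add: powr_mult)
        then show ?thesis
          using i st by (simp add: diam_pow_def ennreal_leI)
      qed
      have "(\<Sum>i\<in>F. diam_pow t (cball (fst i) (5 * snd i)))
          \<le> (\<Sum>i\<in>F. ennreal (10 powr t * \<delta> powr (t - s) * ball_mass M (fst i) (snd i)))"
        by (intro sum_mono bd)
      also have "\<dots> = ennreal (10 powr t * \<delta> powr (t - s) * (\<Sum>(x, r)\<in>F. ball_mass M x r))"
        by (subst sum_ennreal) (auto simp: sum_distrib_left case_prod_beta ball_mass_def)
      also have "\<dots> \<le> ennreal (10 powr t * \<delta> powr (t - s) * 1)"
      proof (intro ennreal_leI mult_left_mono sum_ball_mass_le_1[OF M])
        show "disjoint_family_on (\<lambda>(x, r). cball x r) F"
          using F(2) C(3) unfolding disjoint_family_on_def pairwise_def disjnt_def case_prod_beta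
          by blast
      qed (use F in auto)
      also have "\<dots> \<le> 0 + ennreal e"
        using \<delta> by (simp add: ennreal_leI)
      finally show "(\<Sum>i\<in>F. diam_pow t (cball (fst i) (5 * snd i))) \<le> 0 + ennreal e" .
    qed (use that in auto)
  qed
  then have "hausdorff_premeasure t \<eta> A \<le> 0" if "0 < \<eta>" for \<eta>
    by (rule ennreal_le_epsilon) (use that in simp_all)
  then show ?thesis
    unfolding hausdorff_measure_def by simp
qed

section \<open>Points of small local dimension\<close>

lemma less_ereal_minus_inverse_Suc:
  assumes "a < ereal \<alpha>"
  shows "\<exists>n. a < ereal (\<alpha> - 1 / real (Suc n))"
proof -
  obtain z where z: "a < ereal z" "ereal z < ereal \<alpha>"
    using ereal_dense2[OF assms] by blast
  then obtain n where "1 / real (Suc n) < \<alpha> - z"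
    using nat_approx_posE[of "\<alpha> - z"] by auto
  then have "ereal z < ereal (\<alpha> - 1 / real (Suc n))"
    by simp
  then show ?thesis
    using z by (blast intro: less_trans)
qed

text \<open>The preceding null set results lose a little in the exponent, from \<open>s\<close> to
  some \<open>t > s\<close>. Splitting by gaps \<open>1 / (n + 1)\<close> below
  \<open>\<alpha>\<close> recovers \<open>\<alpha>\<close> itself, the exponent of the positivity
  assumption on \<open>E \<alpha>\<close>.\<close>

lemma packing_measure_upper_local_dim_less:
  assumes "M \<in> borel_prob_measures K"
  shows "packing_measure \<alpha> {x. upper_local_dim M x < ereal \<alpha>} = 0"
proof -
  let ?B = "\<lambda>n. {x. upper_local_dim M x < ereal (\<alpha> - 1 / real (Suc n))}"
  have "{x. upper_local_dim M x < ereal \<alpha>} \<subseteq> (\<Union>n. ?B n)"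
    using less_ereal_minus_inverse_Suc by blast
  then have "packing_measure \<alpha> {x. upper_local_dim M x < ereal \<alpha>} \<le> (\<Sum>n. packing_measure \<alpha> (?B n))"
    by (intro order_trans[OF packing_measure_mono packing_measure_UN_le])
  also have "packing_measure \<alpha> (?B n) = 0" for n
    by (rule packing_measure_eq_0_if_eventually[OF assms, of "\<alpha> - 1 / real (Suc n)"])
       (auto intro: eventually_powr_le_ball_mass)
  then have "(\<Sum>n. packing_measure \<alpha> (?B n)) = 0"
    by simp
  finally show ?thesis
    by simp
qed

lemma hausdorff_measure_lower_local_dim_less:
  fixes M :: "'a::euclidean_space measure"
  assumes "M \<in> borel_prob_measures K" "0 < \<alpha>"
  shows "hausdorff_measure \<alpha> {x. lower_local_dim M x < ereal \<alpha>} = 0"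
proof -
  let ?B = "\<lambda>n. {x. lower_local_dim M x < ereal (\<alpha> - 1 / real (Suc n))}"
  have "{x. lower_local_dim M x < ereal \<alpha>} \<subseteq> (\<Union>n. ?B n)"
    using less_ereal_minus_inverse_Suc by blast
  then have "hausdorff_measure \<alpha> {x. lower_local_dim M x < ereal \<alpha>}
      \<le> (\<Sum>n. hausdorff_measure \<alpha> (?B n))"
    by (intro order_trans[OF hausdorff_measure_mono hausdorff_measure_UN_le])
  also have "hausdorff_measure \<alpha> (?B n) = 0" for n
    by (rule hausdorff_measure_eq_0_if_frequently[OF assms(1), of "\<alpha> - 1 / real (Suc n)"])
       (use assms(2) in \<open>auto intro: frequently_powr_le_ball_mass\<close>)
  then have "(\<Sum>n. hausdorff_measure \<alpha> (?B n)) = 0"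
    by simp
  finally show ?thesis
    by simp
qed

lemma packing_dim_upper_local_dim_le:
  assumes "M \<in> borel_prob_measures K" "0 \<le> \<alpha>" "\<And>x. x \<in> A \<Longrightarrow> upper_local_dim M x \<le> ereal \<alpha>"
  shows "packing_dim A \<le> ereal \<alpha>"
proof (rule packing_dim_leI)
  fix t assume "\<alpha> < t"
  then have "A \<subseteq> {x. upper_local_dim M x < ereal t}"
    using assms(3) by (force intro: le_less_trans)
  then show "packing_measure t A = 0"
    using packing_measure_mono packing_measure_upper_local_dim_less[OF assms(1)]
    by (metis le_zero_eq)
qed (rule assms)

lemma hausdorff_dim_lower_local_dim_le:
  fixes M :: "'a::euclidean_space measure"
  assumes "M \<in> borel_prob_measures K" "0 \<le> \<alpha>" "\<And>x. x \<in> A \<Longrightarrow> lower_local_dim M x \<le> ereal \<alpha>"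
  shows "hausdorff_dim A \<le> ereal \<alpha>"
proof (rule hausdorff_dim_leI)
  fix t assume t: "\<alpha> < t"
  then have "A \<subseteq> {x. lower_local_dim M x < ereal t}"
    using assms(3) by (force intro: le_less_trans)
  moreover have "0 < t"
    using t assms(2) by simp
  ultimately show "hausdorff_measure t A = 0"
    using hausdorff_measure_mono hausdorff_measure_lower_local_dim_less[OF assms(1)]
    by (metis le_zero_eq)
qed (rule assms)

section \<open>Discrete measures with large balls\<close>

text \<open>The constant \<open>c\<close> may depend on the point: the pieces of a countable cover
  come with different constants, and any constant is absorbed by a slightly larger exponent.\<close>

definition ball_mass_ge :: "'a::metric_space pmf \<Rightarrow> real \<Rightarrow> 'a set \<Rightarrow> bool" where
  "ball_mass_ge p \<beta> A \<longleftrightarrow>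
     (\<forall>x\<in>A. \<exists>c>0. \<forall>\<^sub>F r in at_right 0. c * r powr \<beta> \<le> measure_pmf.prob p (cball x r))"

text \<open>All but one term of the integral that gives the mass under the mixture are
  dropped.\<close>

lemma pmf_mult_prob_le_prob_bind:
  "pmf q n * measure_pmf.prob (f n) A \<le> measure_pmf.prob (bind_pmf q f) A"
proof -
  have "ennreal (pmf q n * measure_pmf.prob (f n) A) = (\<integral>\<^sup>+k. emeasure (f n) A * indicator {n} k \<partial>q)"
    by (subst nn_integral_cmult_indicator)
       (simp_all add: measure_pmf_single measure_pmf.emeasure_eq_measure ennreal_mult mult.commute)
  also have "\<dots> \<le> (\<integral>\<^sup>+k. emeasure (f k) A \<partial>q)"
    by (intro nn_integral_mono) (auto simp: indicator_def)
  also have "\<dots> = ennreal (measure_pmf.prob (bind_pmf q f) A)"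
    by (simp flip: measure_pmf.emeasure_eq_measure)
  finally show ?thesis
    by simp
qed

lemma ball_mass_ge_bind:
  assumes "ball_mass_ge (f n) \<beta> A" "0 < pmf q n"
  shows "ball_mass_ge (bind_pmf q f) \<beta> A"
  unfolding ball_mass_ge_def
proof
  fix x assume "x \<in> A"
  then obtain c where c: "0 < c" "\<forall>\<^sub>F r in at_right 0. c * r powr \<beta> \<le> measure_pmf.prob (f n) (cball x r)"
    using assms(1) by (auto simp: ball_mass_ge_def)
  from c(2) have "\<forall>\<^sub>F r in at_right 0.
      (pmf q n * c) * r powr \<beta> \<le> measure_pmf.prob (bind_pmf q f) (cball x r)"
  proof eventually_elim
    case (elim r)
    then have "pmf q n * (c * r powr \<beta>) \<le> pmf q n * measure_pmf.prob (f n) (cball x r)"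
      by (intro mult_left_mono) auto
    also have "\<dots> \<le> measure_pmf.prob (bind_pmf q f) (cball x r)"
      by (rule pmf_mult_prob_le_prob_bind)
    finally show ?case
      by (simp add: mult.assoc)
  qed
  then show "\<exists>c>0. \<forall>\<^sub>F r in at_right 0. c * r powr \<beta> \<le> measure_pmf.prob (bind_pmf q f) (cball x r)"
    using assms(2) c(1) by (intro exI[of _ "pmf q n * c"]) auto
qed

text \<open>The factor \<open>r powr (t - \<beta>)\<close> tends to 0, so it eventually falls below
  \<open>c\<close>.\<close>

lemma eventually_powr_le_of_ball_mass_ge:
  assumes "ball_mass_ge p \<beta> A" "x \<in> A" "\<beta> < t"
  shows "\<forall>\<^sub>F r in at_right 0. r powr t \<le> measure_pmf.prob p (cball x r)"
proof -
  obtain c where c: "0 < c" "\<forall>\<^sub>F r in at_right 0. c * r powr \<beta> \<le> measure_pmf.prob p (cball x r)"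
    using assms by (auto simp: ball_mass_ge_def)
  have "\<forall>\<^sub>F r in at_right 0. 1 * r powr (t - \<beta>) < c"
    using assms c(1) by (intro eventually_mult_powr_less) auto
  with c(2) show ?thesis
  proof eventually_elim
    case (elim r)
    have "r powr t = r powr (t - \<beta>) * r powr \<beta>"
      by (simp flip: powr_add)
    also have "\<dots> \<le> c * r powr \<beta>"
      using elim by (intro mult_right_mono) auto
    finally show ?case
      using elim by simp
  qed
qed

section \<open>Construction of a discrete measure for a single set\<close>

text \<open>Take the first \<open>n\<close> with \<open>a / 2 ^ n \<le> r\<close>. It is positive
  because \<open>r < a\<close>, and the failure of its predecessor is the second inequality.\<close>

lemma exists_dyadic_scale:
  assumes "0 < r" "r < (a::real)"
  obtains n :: nat where "a / 2 ^ n \<le> r" "r < 2 * (a / 2 ^ n)"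
proof -
  obtain k where k: "a / r < 2 ^ k"
    using real_arch_pow[of 2 "a / r"] by auto
  define n where "n = (LEAST n. a / 2 ^ n \<le> r)"
  have "a / 2 ^ k \<le> r"
    using k assms by (simp add: field_simps)
  then have n: "a / 2 ^ n \<le> r"
    unfolding n_def by (rule LeastI)
  then obtain m where m: "n = Suc m"
    using assms by (cases n) auto
  then have "\<not> a / 2 ^ m \<le> r"
    unfolding n_def by (intro not_less_Least) simp
  then have "r < 2 * (a / 2 ^ n)"
    by (simp add: m)
  with n show ?thesis
    by (rule that)
qed

text \<open>Mixing the uniform distributions on the centres at scale \<open>\<delta> / 2 ^ n\<close> with geometric
  weights of ratio \<open>2 powr - (\<beta> - s)\<close> costs only the factor \<open>r powr (\<beta> - s)\<close> at scale \<open>r\<close>.\<close>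

lemma exists_pmf_ball_mass_ge_premeasure:
  fixes U :: "'a::metric_space set"
  assumes U: "U \<noteq> {}" "packing_premeasure s U < \<infinity>" and s: "0 \<le> s" "s < \<beta>"
  shows "\<exists>p. set_pmf p \<subseteq> U \<and> ball_mass_ge p \<beta> U"
proof -
  obtain \<delta> where \<delta>: "0 < \<delta>" "packing_premeasure_at s \<delta> U < \<infinity>"
    using U(2) unfolding packing_premeasure_def INF_less_iff by auto
  define C where "C = enn2real (packing_premeasure_at s \<delta> U)"
  define \<rho> where "\<rho> n = \<delta> / 2 ^ n" for n :: nat
  have \<rho>: "0 < \<rho> n" "\<rho> n \<le> \<delta>" for n
    using \<delta> by (auto simp: \<rho>_def field_simps)
  have "\<exists>S. finite S \<and> S \<subseteq> U \<and> U \<subseteq> (\<Union>x\<in>S. cball x (2 * \<rho> n)) \<and>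
      real (card S) * (2 * \<rho> n) powr s \<le> C" for n
  proof -
    obtain S where S: "finite S" "S \<subseteq> U" "U \<subseteq> (\<Union>x\<in>S. cball x (2 * \<rho> n))"
      and "of_nat (card S) * ennreal ((2 * \<rho> n) powr s) \<le> packing_premeasure_at s \<delta> U"
      using packing_premeasure_finite_cover[OF \<delta>(2) \<rho>] by metis
    then have "ennreal (real (card S) * (2 * \<rho> n) powr s) \<le> packing_premeasure_at s \<delta> U"
      by (simp add: ennreal_mult ennreal_of_nat_eq_real_of_nat)
    then have "real (card S) * (2 * \<rho> n) powr s \<le> C"
      using \<delta>(2) enn2real_mono unfolding C_def by fastforce
    with S show ?thesis
      by blast
  qed
  then obtain S where S: "\<And>n. finite (S n)" "\<And>n. S n \<subseteq> U" "\<And>n. U \<subseteq> (\<Union>x\<in>S n. cball x (2 * \<rho> n))"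
    and card: "\<And>n. real (card (S n)) * (2 * \<rho> n) powr s \<le> C"
    by metis
  have S_ne: "S n \<noteq> {}" for n
    using S(3)[of n] U(1) by auto
  then have card_pos: "0 < card (S n)" for n
    using S(1) by (simp add: card_gt_0_iff)
  \<comment> \<open>The non-empty packing at the coarsest scale shows that \<open>C\<close> is
    positive and can be divided by.\<close>
  have "0 < real (card (S 0)) * (2 * \<rho> 0) powr s"
    using card_pos[of 0] \<rho>(1)[of 0] by simp
  then have C: "0 < C"
    using card[of 0] by linarith
  define \<epsilon> where "\<epsilon> = \<beta> - s"
  \<comment> \<open>With this parameter the geometric weight of scale \<open>n\<close> is
    \<open>\<gamma> * (2 powr - \<epsilon>) ^ n\<close>, hence proportional to
    \<open>\<rho> n powr \<epsilon>\<close>.\<close>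
  define \<gamma> where "\<gamma> = 1 - 2 powr - \<epsilon>"
  have \<epsilon>: "0 < \<epsilon>"
    using s by (simp add: \<epsilon>_def)
  have \<gamma>: "0 < \<gamma>" "\<gamma> < 1"
    using powr_less_mono[of "- \<epsilon>" 0 2] \<epsilon> by (auto simp: \<gamma>_def)
  define p where "p = bind_pmf (geometric_pmf \<gamma>) (\<lambda>n. pmf_of_set (S n))"
  have "set_pmf p \<subseteq> U"
    using S S_ne by (auto simp: p_def set_pmf_of_set)
  moreover have "ball_mass_ge p \<beta> U"
    unfolding ball_mass_ge_def
  proof
    fix x assume x: "x \<in> U"
    \<comment> \<open>The product of the two lower bounds below,
      \<open>\<gamma> * (r / (4 * \<delta>)) powr \<epsilon>\<close> for the weight of the scale and
      \<open>(r / 2) powr s / C\<close> for the uniform distribution, with the powers of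
      \<open>r\<close> taken out.\<close>
    define c where "c = \<gamma> * (1 / (4 * \<delta>)) powr \<epsilon> * ((1 / 2) powr s / C)"
    have "c * r powr \<beta> \<le> measure_pmf.prob p (cball x r)" if r: "0 < r" "r < 2 * \<delta>" for r
    proof -
      \<comment> \<open>The scale with \<open>2 * \<rho> n \<le> r < 4 * \<rho> n\<close>. The first
        inequality puts a centre into \<open>cball x r\<close>; the second bounds the weight from
        below and the number of centres from above.\<close>
      obtain n where n: "2 * \<delta> / 2 ^ n \<le> r" "r < 2 * (2 * \<delta> / 2 ^ n)"
        using exists_dyadic_scale[OF r] .
      have "\<gamma> * (r / (4 * \<delta>)) powr \<epsilon> \<le> \<gamma> * (1 / 2 ^ n) powr \<epsilon>"
        using n(2) \<gamma> \<delta> \<epsilon> r by (intro mult_left_mono powr_mono2) (auto simp: field_simps)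
      also have "(1 / 2 ^ n :: real) powr \<epsilon> = (2 powr - real n) powr \<epsilon>"
        by (simp add: powr_minus powr_realpow inverse_eq_divide)
      also have "\<dots> = (2 powr - \<epsilon>) powr real n"
        by (simp add: powr_powr mult.commute)
      also have "\<dots> = (1 - \<gamma>) ^ n"
        by (simp add: \<gamma>_def powr_realpow)
      finally have weight: "\<gamma> * (r / (4 * \<delta>)) powr \<epsilon> \<le> pmf (geometric_pmf \<gamma>) n"
        using \<gamma> by (simp add: mult.commute)
      have "(r / 2) powr s \<le> (2 * \<rho> n) powr s"
        using n(2) r s by (intro powr_mono2) (auto simp: \<rho>_def)
      also have "\<dots> \<le> C / card (S n)"
        using card[of n] card_pos[of n] by (simp add: field_simps)
      finally have "(r / 2) powr s / C \<le> 1 / card (S n)"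
        using C card_pos[of n] by (simp add: field_simps)
      also have "\<dots> \<le> measure_pmf.prob (pmf_of_set (S n)) (cball x r)"
      proof -
        obtain y where y: "y \<in> S n" "x \<in> cball y (2 * \<rho> n)"
          using S(3)[of n] x by blast
        then have "y \<in> S n \<inter> cball x r"
          using n(1) by (auto simp: \<rho>_def dist_commute)
        then have "1 \<le> card (S n \<inter> cball x r)"
          using S(1)[of n] by (metis One_nat_def Suc_leI card_gt_0_iff empty_iff finite_Int)
        then show ?thesis
          using S(1)[of n] S_ne[of n] by (simp add: measure_pmf_of_set divide_right_mono)
      qed
      finally have unif: "(r / 2) powr s / C \<le> measure_pmf.prob (pmf_of_set (S n)) (cball x r)" .
      have "r powr \<beta> = r powr \<epsilon> * r powr s"
        by (simp add: \<epsilon>_def flip: powr_add)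
      then have "c * r powr \<beta> = (\<gamma> * (r / (4 * \<delta>)) powr \<epsilon>) * ((r / 2) powr s / C)"
        using \<delta> r by (simp add: c_def powr_divide)
      also have "\<dots> \<le> pmf (geometric_pmf \<gamma>) n * measure_pmf.prob (pmf_of_set (S n)) (cball x r)"
        using weight unif C by (intro mult_mono) auto
      also have "\<dots> \<le> measure_pmf.prob p (cball x r)"
        unfolding p_def by (rule pmf_mult_prob_le_prob_bind)
      finally show ?thesis .
    qed
    moreover have "\<forall>\<^sub>F r in at_right 0. 0 < r \<and> r < 2 * \<delta>"
      using eventually_at_right_real[of 0 "2 * \<delta>"] \<delta> by simp
    ultimately have "\<forall>\<^sub>F r in at_right 0. c * r powr \<beta> \<le> measure_pmf.prob p (cball x r)"
      by (auto elim: eventually_mono)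
    moreover have "0 < c"
      using \<gamma> \<delta> C by (simp add: c_def)
    ultimately show "\<exists>c>0. \<forall>\<^sub>F r in at_right 0. c * r powr \<beta> \<le> measure_pmf.prob p (cball x r)"
      by blast
  qed
  ultimately show ?thesis
    by blast
qed

lemma pmf_geometric_half_pos: "0 < pmf (geometric_pmf (1 / 2)) n"
  by simp

lemma exists_pmf_ball_mass_ge:
  assumes "packing_dim A < ereal \<beta>" "A \<noteq> {}"
  shows "\<exists>p. set_pmf p \<subseteq> A \<and> ball_mass_ge p \<beta> A"
proof -
  obtain s where s: "0 \<le> s" "s < \<beta>" "packing_measure s A = 0"
    using assms(1) unfolding packing_dim_def INF_less_iff by auto
  \<comment> \<open>Any finite bound would do: it yields a cover by sets of finite
    premeasure.\<close>
  then have "packing_measure s A < 1"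
    by simp
  then obtain U :: "nat \<Rightarrow> 'a set" where U: "A \<subseteq> (\<Union>i. U i)" "(\<Sum>i. packing_premeasure s (U i)) < 1"
    unfolding packing_measure_def INF_less_iff by auto
  \<comment> \<open>Intersecting with \<open>A\<close> keeps the centres, and so the support of the
    mixture, inside \<open>A\<close>.\<close>
  have "packing_premeasure s (A \<inter> U i) < \<infinity>" for i
  proof -
    have "packing_premeasure s (A \<inter> U i) \<le> packing_premeasure s (U i)"
      by (rule packing_premeasure_mono) simp
    also have "\<dots> < 1"
      using U(2) by (rule ennreal_suminf_lessD)
    also have "(1::ennreal) < \<infinity>"
      by simp
    finally show ?thesis .
  qed
  then have piece: "\<exists>p. set_pmf p \<subseteq> A \<inter> U i \<and> ball_mass_ge p \<beta> (A \<inter> U i)" if "A \<inter> U i \<noteq> {}" for i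
    using exists_pmf_ball_mass_ge_premeasure[OF that _ s(1,2)] by blast
  have "\<exists>p. set_pmf p \<subseteq> A \<and> ball_mass_ge p \<beta> (A \<inter> U i)" for i
  proof (cases "A \<inter> U i = {}")
    case True
    \<comment> \<open>A point mass stands in for an empty piece, on which the lower bound is
      vacuous.\<close>
    obtain a where "a \<in> A"
      using assms(2) by blast
    then show ?thesis
      using True by (intro exI[of _ "return_pmf a"]) (auto simp: ball_mass_ge_def)
  next
    case False
    then show ?thesis
      using piece by blast
  qed
  then obtain f where f: "\<And>i. set_pmf (f i) \<subseteq> A" "\<And>i. ball_mass_ge (f i) \<beta> (A \<inter> U i)"
    by metis
  let ?p = "bind_pmf (geometric_pmf (1 / 2)) f"
  have "ball_mass_ge ?p \<beta> (A \<inter> U i)" for i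
    using f(2) pmf_geometric_half_pos by (rule ball_mass_ge_bind)
  then have "ball_mass_ge ?p \<beta> A"
    using U(1) unfolding ball_mass_ge_def by blast
  moreover have "set_pmf ?p \<subseteq> A"
    using f(1) by auto
  ultimately show ?thesis
    by blast
qed

section \<open>One measure for the whole family\<close>

text \<open>Countably many components suffice, one for each pair of rationals \<open>a\<close> and
  \<open>b\<close>: given \<open>x\<close> in \<open>E \<alpha>\<close> and
  \<open>\<alpha> < t\<close>, choose \<open>\<alpha> < a < b < t\<close> with \<open>a < D\<close>.
  Then \<open>x\<close> lies in \<open>E a\<close> since the family is increasing, and the component
  for \<open>E a\<close> with exponent \<open>b\<close> gives the bound.\<close>

lemma exists_pmf_family_ball_mass:
  fixes E :: "real \<Rightarrow> 'a::metric_space set" and D :: ereal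
  assumes ne: "K \<noteq> {}"
    and sub: "\<And>\<alpha>. 0 < \<alpha> \<Longrightarrow> ereal \<alpha> < D \<Longrightarrow> E \<alpha> \<subseteq> K"
    and mono: "\<And>\<alpha> \<beta>. 0 < \<alpha> \<Longrightarrow> \<alpha> \<le> \<beta> \<Longrightarrow> ereal \<beta> < D \<Longrightarrow> E \<alpha> \<subseteq> E \<beta>"
    and dim: "\<And>\<alpha>. 0 < \<alpha> \<Longrightarrow> ereal \<alpha> < D \<Longrightarrow> packing_dim (E \<alpha>) \<le> ereal \<alpha>"
  shows "\<exists>p. set_pmf p \<subseteq> K \<and> (\<forall>\<alpha> x t. 0 < \<alpha> \<and> ereal \<alpha> < D \<and> x \<in> E \<alpha> \<and> \<alpha> < t \<longrightarrow>
    (\<forall>\<^sub>F r in at_right 0. r powr t \<le> measure_pmf.prob p (cball x r)))"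
proof -
  have "\<exists>p. set_pmf p \<subseteq> K \<and>
      (0 < a \<and> ereal a < D \<and> a < b \<longrightarrow> ball_mass_ge p b (E a))" for a b
  proof (cases "0 < a \<and> ereal a < D \<and> a < b \<and> E a \<noteq> {}")
    case True
    then have "packing_dim (E a) < ereal b"
      using dim[of a] by (auto intro: le_less_trans)
    then show ?thesis
      using exists_pmf_ball_mass_ge[of "E a" b] True sub[of a] by blast
  next
    case False
    \<comment> \<open>For parameters out of range or an empty \<open>E a\<close> nothing is demanded
      except a distribution on \<open>K\<close>.\<close>
    obtain k where "k \<in> K"
      using ne by blast
    then show ?thesis
      using False by (intro exI[of _ "return_pmf k"]) (auto simp: ball_mass_ge_def)
  qed
  then obtain f where f: "\<And>a b. set_pmf (f a b) \<subseteq> K"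
    "\<And>a b. 0 < a \<Longrightarrow> ereal a < D \<Longrightarrow> a < b \<Longrightarrow> ball_mass_ge (f a b) b (E a)"
    by metis
  define g where "g n = (case from_nat n of (a, b) \<Rightarrow> f (of_rat a) (of_rat b))" for n
  define p where "p = bind_pmf (geometric_pmf (1 / 2)) g"
  have p_rat: "ball_mass_ge p (of_rat b) (E (of_rat a))"
    if "0 < (of_rat a :: real)" "ereal (of_rat a) < D" "of_rat a < (of_rat b :: real)" for a b
  proof -
    have "ball_mass_ge (g (to_nat (a, b))) (of_rat b) (E (of_rat a))"
      using f(2)[OF that] by (simp add: g_def)
    then show ?thesis
      unfolding p_def using pmf_geometric_half_pos by (rule ball_mass_ge_bind)
  qed
  have "\<forall>\<^sub>F r in at_right 0. r powr t \<le> measure_pmf.prob p (cball x r)"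
    if \<alpha>: "0 < \<alpha>" "ereal \<alpha> < D" "x \<in> E \<alpha>" "\<alpha> < t" for \<alpha> x t
  proof -
    \<comment> \<open>The number \<open>z\<close> leaves room for \<open>a\<close> between
      \<open>\<alpha>\<close> and \<open>z\<close>, still below \<open>D\<close>, and for
      \<open>b\<close> between \<open>z\<close> and \<open>t\<close>.\<close>
    obtain z where z: "ereal \<alpha> < ereal z" "ereal z < min D (ereal t)"
      using ereal_dense2[of "ereal \<alpha>" "min D (ereal t)"] \<alpha> by auto
    obtain a where a: "\<alpha> < of_rat a" "of_rat a < z"
      using of_rat_dense[of \<alpha> z] z by auto
    obtain b where b: "z < of_rat b" "of_rat b < t"
      using of_rat_dense[of z t] z by auto
    have aD: "ereal (of_rat a) < D"
      using a(2) z(2) less_trans[of "ereal (of_rat a)" "ereal z" D] by simp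
    have "0 < (of_rat a :: real)"
      using a(1) \<alpha>(1) by linarith
    then have "ball_mass_ge p (of_rat b) (E (of_rat a))"
      using p_rat[OF _ aD] a(2) b(1) by (meson less_trans)
    moreover have "x \<in> E (of_rat a)"
      using mono[of \<alpha> "of_rat a"] a \<alpha> aD by auto
    ultimately show ?thesis
      using b(2) by (rule eventually_powr_le_of_ball_mass_ge)
  qed
  moreover have "set_pmf (g n) \<subseteq> K" for n
    by (simp add: g_def case_prod_beta f(1))
  then have "set_pmf p \<subseteq> K"
    by (auto simp: p_def)
  ultimately show ?thesis
    by blast
qed

text \<open>A \<open>pmf\<close> measures all subsets of the whole type. Pushing it forward to the
  Borel sets and restricting it to \<open>K\<close> gives a measure of the required form, and ball
  masses are unchanged because \<open>p\<close> has no mass outside \<open>K\<close>.\<close>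

lemma borel_prob_measure_of_pmf:
  fixes K :: "'a::metric_space set"
  assumes "K \<in> sets borel" "set_pmf p \<subseteq> K"
  obtains M where "M \<in> borel_prob_measures K"
    "\<And>x r. ball_mass M x r = measure_pmf.prob p (cball x r)"
proof -
  let ?N = "distr (measure_pmf p) borel (\<lambda>x. x)"
  have N: "emeasure ?N A = emeasure p A" if "A \<in> sets borel" for A
    using that by (subst emeasure_distr) auto
  have AE: "AE x in measure_pmf p. x \<in> K"
    using assms(2) by (auto simp: AE_measure_pmf_iff)
  define M where "M = restrict_space ?N K"
  have "emeasure ?N K = 1"
    using assms(1) N AE by (simp add: measure_pmf.emeasure_eq_1_AE)
  then have "prob_space M"
    unfolding M_def using assms(1) by (intro prob_space_restrict_space) auto
  moreover have "sets M = sets (restrict_space borel K)"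
    by (simp add: M_def sets_restrict_space)
  ultimately have "M \<in> borel_prob_measures K"
    by (simp add: borel_prob_measures_def)
  moreover have "ball_mass M x r = measure_pmf.prob p (cball x r)" for x r
  proof -
    have "ball_mass M x r = measure ?N (cball x r \<inter> K)"
      using assms(1) by (simp add: ball_mass_def M_def space_restrict_space measure_restrict_space)
    also have "\<dots> = measure_pmf.prob p (cball x r \<inter> K)"
      using assms(1) N by (simp add: measure_def)
    also have "\<dots> = measure_pmf.prob p (cball x r)"
      using AE by (intro measure_pmf.finite_measure_eq_AE) auto
    finally show ?thesis .
  qed
  ultimately show ?thesis
    by (rule that)
qed

lemma exists_measure_upper_local_dim_le:
  fixes K :: "'a::metric_space set"
  assumes "compact K" "K \<noteq> {}" and E: "increasing_compact_family K E"
    and dim: "\<And>\<alpha>. 0 < \<alpha> \<Longrightarrow> ereal \<alpha> < packing_dim K \<Longrightarrow> packing_dim (E \<alpha>) \<le> ereal \<alpha>"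
  obtains M where "M \<in> borel_prob_measures K"
    "\<And>\<alpha> x. 0 < \<alpha> \<Longrightarrow> ereal \<alpha> < packing_dim K \<Longrightarrow> x \<in> E \<alpha> \<Longrightarrow> upper_local_dim M x \<le> ereal \<alpha>"
proof -
  have "\<exists>p. set_pmf p \<subseteq> K \<and> (\<forall>\<alpha> x t. 0 < \<alpha> \<and> ereal \<alpha> < packing_dim K \<and> x \<in> E \<alpha> \<and> \<alpha> < t \<longrightarrow>
      (\<forall>\<^sub>F r in at_right 0. r powr t \<le> measure_pmf.prob p (cball x r)))"
    using E by (intro exists_pmf_family_ball_mass assms(2) dim)
      (auto simp: increasing_compact_family_def)
  then obtain p where p: "set_pmf p \<subseteq> K"
    "\<And>\<alpha> x t. 0 < \<alpha> \<Longrightarrow> ereal \<alpha> < packing_dim K \<Longrightarrow> x \<in> E \<alpha> \<Longrightarrow> \<alpha> < t \<Longrightarrow>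
      (\<forall>\<^sub>F r in at_right 0. r powr t \<le> measure_pmf.prob p (cball x r))"
    by blast
  have "K \<in> sets borel"
    using assms(1) by (rule borel_compact)
  from borel_prob_measure_of_pmf[OF this p(1)]
  obtain M where M: "M \<in> borel_prob_measures K"
    "\<And>x r. ball_mass M x r = measure_pmf.prob p (cball x r)"
    by metis
  then show ?thesis
    using p(2) by (intro that[of M] upper_local_dim_leI) auto
qed

section \<open>Dimensions of the level sets\<close>

text \<open>Points of \<open>A\<close> outside the level set have upper local dimension below
  \<open>\<alpha>\<close> and form a null set for the \<open>\<alpha>\<close>-dimensional packing
  measure, so the level set inherits non-zero measure from \<open>A\<close>.\<close>

lemma packing_dim_upper_level_set:
  assumes M: "M \<in> borel_prob_measures K" and \<alpha>: "0 < \<alpha>" and "A \<subseteq> K"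
    and upper: "\<And>x. x \<in> A \<Longrightarrow> upper_local_dim M x \<le> ereal \<alpha>" and pos: "packing_measure \<alpha> A > 0"
  shows "packing_dim (upper_level_set K M \<alpha>) = ereal \<alpha>"
proof (rule antisym)
  show "packing_dim (upper_level_set K M \<alpha>) \<le> ereal \<alpha>"
    using \<alpha> by (intro packing_dim_upper_local_dim_le[OF M]) (auto simp: upper_level_set_def)
  \<comment> \<open>A union of two sets written as a sequence, for countable subadditivity;
    repeating the null set at every \<open>n > 0\<close> adds nothing.\<close>
  define B where "B n = (if n = 0 then upper_level_set K M \<alpha> else {x. upper_local_dim M x < ereal \<alpha>})"
    for n :: nat
  have "x \<in> B 0 \<union> B 1" if "x \<in> A" for x
    using upper[OF that] that \<open>A \<subseteq> K\<close> by (auto simp: B_def upper_level_set_def)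
  then have "A \<subseteq> (\<Union>n. B n)"
    by blast
  then have "packing_measure \<alpha> A \<le> (\<Sum>n. packing_measure \<alpha> (B n))"
    by (intro order_trans[OF packing_measure_mono packing_measure_UN_le])
  then have "\<exists>n. packing_measure \<alpha> (B n) \<noteq> 0"
    using pos by - (rule ccontr, simp)
  then have "packing_measure \<alpha> (upper_level_set K M \<alpha>) \<noteq> 0"
    by (auto simp: B_def packing_measure_upper_local_dim_less[OF M] split: if_splits)
  then show "ereal \<alpha> \<le> packing_dim (upper_level_set K M \<alpha>)"
    by (rule packing_dim_geI)
qed

text \<open>On \<open>A\<close> the upper local dimension is at most \<open>\<alpha>\<close>, so
  both local dimensions equal \<open>\<alpha>\<close> unless the lower one is smaller, which happens
  on a Hausdorff null set only. The level set thus has non-zero Hausdorff measure and, by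
  comparison, non-zero packing measure, which gives both lower bounds.\<close>

lemma dim_level_set:
  fixes K :: "'a::euclidean_space set"
  assumes M: "M \<in> borel_prob_measures K" and \<alpha>: "0 < \<alpha>" and "A \<subseteq> K"
    and upper: "\<And>x. x \<in> A \<Longrightarrow> upper_local_dim M x \<le> ereal \<alpha>" and pos: "hausdorff_measure \<alpha> A > 0"
  shows "hausdorff_dim (level_set K M \<alpha>) = ereal \<alpha>" "packing_dim (level_set K M \<alpha>) = ereal \<alpha>"
proof -
  define B where "B n = (if n = 0 then level_set K M \<alpha> else {x. lower_local_dim M x < ereal \<alpha>})"
    for n :: nat
  have "x \<in> B 0 \<union> B 1" if "x \<in> A" for x
    using upper[OF that] that \<open>A \<subseteq> K\<close> lower_local_dim_le_upper[of M x]
    by (auto simp: B_def level_set_def)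
  then have "A \<subseteq> (\<Union>n. B n)"
    by blast
  then have "hausdorff_measure \<alpha> A \<le> (\<Sum>n. hausdorff_measure \<alpha> (B n))"
    by (intro order_trans[OF hausdorff_measure_mono hausdorff_measure_UN_le])
  then have "\<exists>n. hausdorff_measure \<alpha> (B n) \<noteq> 0"
    using pos by - (rule ccontr, simp)
  then have H: "hausdorff_measure \<alpha> (level_set K M \<alpha>) \<noteq> 0"
    by (auto simp: B_def hausdorff_measure_lower_local_dim_less[OF M \<alpha>] split: if_splits)
  then have P: "packing_measure \<alpha> (level_set K M \<alpha>) \<noteq> 0"
    using hausdorff_measure_le_packing_measure[OF \<alpha>, of "level_set K M \<alpha>"] by auto
  show "hausdorff_dim (level_set K M \<alpha>) = ereal \<alpha>"
    using \<alpha> by (intro antisym hausdorff_dim_lower_local_dim_le[OF M] hausdorff_dim_geI[OF H])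
      (auto simp: level_set_def)
  show "packing_dim (level_set K M \<alpha>) = ereal \<alpha>"
    using \<alpha> by (intro antisym packing_dim_upper_local_dim_le[OF M] packing_dim_geI[OF P])
      (auto simp: level_set_def)
qed

theorem theorem1p5:
  fixes K :: "(real ^ 'd) set"
  assumes "compact K" and "K \<noteq> {}"
  shows
    "((\<exists>E. increasing_compact_family K E \<and>
          (\<forall>\<alpha>::real. 0 < \<alpha> \<and> ereal \<alpha> < packing_dim K \<longrightarrow>
             packing_dim (E \<alpha>) = ereal \<alpha> \<and> packing_measure \<alpha> (E \<alpha>) > 0))
      \<longrightarrow> (\<exists>\<mu> \<in> borel_prob_measures K.
            \<forall>\<alpha>::real. 0 < \<alpha> \<and> ereal \<alpha> < packing_dim K \<longrightarrow>
              packing_dim (upper_level_set K \<mu> \<alpha>) = ereal \<alpha>))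
     \<and>
     ((\<exists>E. increasing_compact_family K E \<and>
          (\<forall>\<alpha>::real. 0 < \<alpha> \<and> ereal \<alpha> < packing_dim K \<longrightarrow>
             packing_dim (E \<alpha>) = ereal \<alpha> \<and> hausdorff_measure \<alpha> (E \<alpha>) > 0))
      \<longrightarrow> (\<exists>\<mu> \<in> borel_prob_measures K.
            \<forall>\<alpha>::real. 0 < \<alpha> \<and> ereal \<alpha> < packing_dim K \<longrightarrow>
              hausdorff_dim (level_set K \<mu> \<alpha>) = ereal \<alpha> \<and>
              packing_dim (level_set K \<mu> \<alpha>) = ereal \<alpha>))"
proof (intro conjI impI; elim exE conjE)
  fix E assume E: "increasing_compact_family K E"
    and dim: "\<forall>\<alpha>. 0 < \<alpha> \<and> ereal \<alpha> < packing_dim K \<longrightarrow>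
      packing_dim (E \<alpha>) = ereal \<alpha> \<and> packing_measure \<alpha> (E \<alpha>) > 0"
  obtain M where M: "M \<in> borel_prob_measures K"
    "\<And>\<alpha> x. 0 < \<alpha> \<Longrightarrow> ereal \<alpha> < packing_dim K \<Longrightarrow> x \<in> E \<alpha> \<Longrightarrow> upper_local_dim M x \<le> ereal \<alpha>"
    using exists_measure_upper_local_dim_le[OF assms E] dim by auto
  have "packing_dim (upper_level_set K M \<alpha>) = ereal \<alpha>"
    if "0 < \<alpha> \<and> ereal \<alpha> < packing_dim K" for \<alpha>
    using that E dim M(2)
    by (intro packing_dim_upper_level_set[OF M(1), of \<alpha> "E \<alpha>"])
       (auto simp: increasing_compact_family_def)
  with M(1) show "\<exists>\<mu>\<in>borel_prob_measures K. \<forall>\<alpha>. 0 < \<alpha> \<and> ereal \<alpha> < packing_dim K \<longrightarrow>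
      packing_dim (upper_level_set K \<mu> \<alpha>) = ereal \<alpha>"
    by blast
next
  fix E assume E: "increasing_compact_family K E"
    and dim: "\<forall>\<alpha>. 0 < \<alpha> \<and> ereal \<alpha> < packing_dim K \<longrightarrow>
      packing_dim (E \<alpha>) = ereal \<alpha> \<and> hausdorff_measure \<alpha> (E \<alpha>) > 0"
  \<comment> \<open>The construction is that of the first claim, as it relies on the monotonicity
    and the packing dimensions of the family. The Hausdorff measures enter through
    \<open>dim_level_set\<close>.\<close>
  obtain M where M: "M \<in> borel_prob_measures K"
    "\<And>\<alpha> x. 0 < \<alpha> \<Longrightarrow> ereal \<alpha> < packing_dim K \<Longrightarrow> x \<in> E \<alpha> \<Longrightarrow> upper_local_dim M x \<le> ereal \<alpha>"
    using exists_measure_upper_local_dim_le[OF assms E] dim by auto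
  have "hausdorff_dim (level_set K M \<alpha>) = ereal \<alpha> \<and> packing_dim (level_set K M \<alpha>) = ereal \<alpha>"
    if "0 < \<alpha> \<and> ereal \<alpha> < packing_dim K" for \<alpha>
    using that E dim M(2)
    by (intro conjI dim_level_set[OF M(1), of \<alpha> "E \<alpha>"])
       (auto simp: increasing_compact_family_def)
  with M(1) show "\<exists>\<mu>\<in>borel_prob_measures K. \<forall>\<alpha>. 0 < \<alpha> \<and> ereal \<alpha> < packing_dim K \<longrightarrow>
      hausdorff_dim (level_set K \<mu> \<alpha>) = ereal \<alpha> \<and> packing_dim (level_set K \<mu> \<alpha>) = ereal \<alpha>"
    by blast
qed

end
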